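(* Let $p\in[1,\infty]$ and $T>0$. Let $W\in L^1((0,1)^2)$ be a graphon with $W(x,y)=W(y,x)\ge0$ for all $(x,y)\in(0,1)^2$ and $\int_0^1W(x,y)\,dy\le1$ for a.e. $x\in(0,1)$. Let $u\in C^1([0,T];L^p((0,1)))$ be a classical solution of the graphon diffusion equation $\partial_t u=\mathcal{L}^Wu$ with initial condition $u(\cdot,0)=u_0\in L^p((0,1))$. Then $$\sup_{t\in[0,T]}\|u(\cdot,t)\|_p\le\|u_0\|_p.$$
   Context: The graphon diffusion operator is $\mathcal{L}^W u(x)=\int_0^1 W(x,y)\,(u(y)-u(x))\,dy$; under the stated hypotheses on $W$ it is a bounded linear operator on $L^p((0,1))$ for every $p\in[1,\infty]$. A classical solution is one for which the equation holds as an identity in $L^p((0,1))$ for $t\in[0,T]$. *)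

theory Defs
  imports "HOL-Analysis.Analysis" "HOL-Probability.Essential_Supremum"
begin

text \<open>The \<open>L\<^sup>p\<close> norm for an extended exponent \<open>p \<in> [1, \<infinity>]\<close>, with value \<open>\<infinity>\<close> for
  measurable functions outside \<open>L\<^sup>p\<close>.
  Elements of \<open>L\<^sup>p\<close> are represented by functions; identities in \<open>L\<^sup>p\<close> are therefore
  stated almost everywhere.\<close>

definition Lp_norm :: "ennreal \<Rightarrow> 'a measure \<Rightarrow> ('a \<Rightarrow> real) \<Rightarrow> ennreal" where
  "Lp_norm p M f =
    (if p = \<infinity> then esssup M (\<lambda>x. ennreal \<bar>f x\<bar>)
     else let q = enn2real p; I = (\<integral>\<^sup>+ x. ennreal (\<bar>f x\<bar> powr q) \<partial>M)
          in if I = \<infinity> then \<infinity> else ennreal (enn2real I powr (1 / q)))"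

definition Lp_space :: "ennreal \<Rightarrow> 'a measure \<Rightarrow> ('a \<Rightarrow> real) set" where
  "Lp_space p M = {f \<in> borel_measurable M. Lp_norm p M f < \<infinity>}"

definition Lp_continuous_on ::
    "ennreal \<Rightarrow> 'a measure \<Rightarrow> real set \<Rightarrow> (real \<Rightarrow> 'a \<Rightarrow> real) \<Rightarrow> bool" where
  "Lp_continuous_on p M S u \<longleftrightarrow>
    (\<forall>t\<in>S. u t \<in> Lp_space p M) \<and>
    (\<forall>t\<in>S. ((\<lambda>s. Lp_norm p M (\<lambda>x. u s x - u t x)) \<longlongrightarrow> 0) (at t within S))"

text \<open>\<open>u \<in> C\<^sup>1(S; L\<^sup>p)\<close> with derivative \<open>v\<close>: difference quotients converge in the \<open>L\<^sup>p\<close> norm,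
  from one side only at the end points when \<open>S\<close> is a compact interval.\<close>

definition has_C1_Lp_derivative ::
    "ennreal \<Rightarrow> 'a measure \<Rightarrow> real set \<Rightarrow> (real \<Rightarrow> 'a \<Rightarrow> real) \<Rightarrow> (real \<Rightarrow> 'a \<Rightarrow> real) \<Rightarrow> bool" where
  "has_C1_Lp_derivative p M S u v \<longleftrightarrow>
    Lp_continuous_on p M S u \<and> Lp_continuous_on p M S v \<and>
    (\<forall>t\<in>S. ((\<lambda>s. Lp_norm p M (\<lambda>x. (u s x - u t x) / (s - t) - v t x)) \<longlongrightarrow> 0)
       (at t within S))"

abbreviation unit_leb :: "real measure" where
  "unit_leb \<equiv> lebesgue_on {0<..<1}"

definition graphon_diffusion :: "(real \<Rightarrow> real \<Rightarrow> real) \<Rightarrow> (real \<Rightarrow> real) \<Rightarrow> real \<Rightarrow> real" where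
  "graphon_diffusion W f x = (\<integral>y. W x y * (f y - f x) \<partial>unit_leb)"

definition classical_solution ::
    "ennreal \<Rightarrow> (real \<Rightarrow> real \<Rightarrow> real) \<Rightarrow> real \<Rightarrow> (real \<Rightarrow> real) \<Rightarrow> (real \<Rightarrow> real \<Rightarrow> real) \<Rightarrow> bool" where
  "classical_solution p W T u0 u \<longleftrightarrow>
    (\<exists>v. has_C1_Lp_derivative p unit_leb {0..T} u v \<and>
         (\<forall>t\<in>{0..T}. AE x in unit_leb. v t x = graphon_diffusion W (u t) x)) \<and>
    (AE x in unit_leb. u 0 x = u0 x)"

end

theory Submission
  imports Defs
begin

text \<open>Write \<open>\<L>\<^sup>W = A - I\<close> with \<open>A f x = \<integral> W x y * f y dy + (1 - d x) * f x\<close> and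
  \<open>d x = \<integral> W x y dy \<le> 1\<close>. The weights defining \<open>A f x\<close> are nonnegative with total mass 1, and by the
  symmetry of \<open>W\<close> the operator \<open>A\<close> preserves integrals, so Jensen's inequality makes \<open>A\<close> a
  contraction on every \<open>L\<^sup>p\<close>. From \<open>(1 + h) u(t) = u(t - h) + h A u(t) + o(h)\<close> one gets
  \<open>\<parallel>u(t)\<parallel> \<le> \<parallel>u(t - h)\<parallel> + o(h)\<close>, and a continuous function whose left Dini derivative is nowhere
  positive does not increase.\<close>

section \<open>The extended \<open>L\<^sup>p\<close> norm: bounds, monotonicity, homogeneity\<close>

lemma le_ennreal_realI:
  fixes x y :: ennreal
  assumes "\<And>a. 0 \<le> a \<Longrightarrow> y \<le> ennreal a \<Longrightarrow> x \<le> ennreal a"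
  shows "x \<le> y"
  using assms by (cases y) auto

text \<open>The essential supremum is itself an almost-everywhere bound, and it is the least
  one.\<close>

lemma Lp_norm_infinity_le_iff:
  assumes "f \<in> borel_measurable M"
  shows "Lp_norm \<infinity> M f \<le> c \<longleftrightarrow> (AE x in M. ennreal \<bar>f x\<bar> \<le> c)"
proof
  assume "Lp_norm \<infinity> M f \<le> c"
  then show "AE x in M. ennreal \<bar>f x\<bar> \<le> c"
    using esssup_AE[of "\<lambda>x. ennreal \<bar>f x\<bar>" M] by (auto simp: Lp_norm_def)
next
  assume "AE x in M. ennreal \<bar>f x\<bar> \<le> c"
  then show "Lp_norm \<infinity> M f \<le> c"
    using assms by (auto simp: Lp_norm_def intro!: esssup_I)
qed

lemma one_le_enn2real:
  assumes "1 \<le> p" "p \<noteq> \<infinity>"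
  shows "1 \<le> enn2real p"
  using assms by (cases p) auto

text \<open>Taking \<open>q\<close>-th powers is monotone on nonnegative reals, and an infinite
  integral makes both sides false. This removes the root and the case distinction of
  \<open>Lp_norm\<close>, so later estimates deal with integrals only.\<close>

lemma Lp_norm_le_iff:
  assumes p: "1 \<le> p" "p \<noteq> \<infinity>" and a: "0 \<le> a"
  shows "Lp_norm p M f \<le> ennreal a \<longleftrightarrow>
    (\<integral>\<^sup>+x. ennreal (\<bar>f x\<bar> powr enn2real p) \<partial>M) \<le> ennreal (a powr enn2real p)"
proof -
  let ?q = "enn2real p"
  have q: "1 \<le> ?q" by (rule one_le_enn2real[OF p])
  let ?I = "\<integral>\<^sup>+x. ennreal (\<bar>f x\<bar> powr ?q) \<partial>M"
  show ?thesis
  proof (cases ?I)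
    case top
    then show ?thesis using p by (auto simp: Lp_norm_def Let_def top_unique)
  next
    case (real r)
    have "r powr (1 / ?q) \<le> a \<longleftrightarrow> r \<le> a powr ?q"
    proof
      assume "r powr (1 / ?q) \<le> a"
      then have "(r powr (1 / ?q)) powr ?q \<le> a powr ?q"
        using q by (intro powr_mono2) auto
      then show "r \<le> a powr ?q" using q real by (simp add: powr_powr)
    next
      assume "r \<le> a powr ?q"
      then have "r powr (1 / ?q) \<le> (a powr ?q) powr (1 / ?q)"
        using q real by (intro powr_mono2) auto
      then show "r powr (1 / ?q) \<le> a" using q a by (simp add: powr_powr)
    qed
    then show ?thesis using p a real by (simp add: Lp_norm_def Let_def)
  qed
qed

lemma Lp_norm_le_if_nn_integral_powr_le:
  assumes p: "1 \<le> p" "p \<noteq> \<infinity>"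
    and le: "(\<integral>\<^sup>+x. ennreal (\<bar>f x\<bar> powr enn2real p) \<partial>M)
      \<le> (\<integral>\<^sup>+x. ennreal (\<bar>g x\<bar> powr enn2real p) \<partial>M)"
  shows "Lp_norm p M f \<le> Lp_norm p M g"
proof (rule le_ennreal_realI)
  fix a :: real assume a: "0 \<le> a" and "Lp_norm p M g \<le> ennreal a"
  then show "Lp_norm p M f \<le> ennreal a"
    unfolding Lp_norm_le_iff[OF p a] by (intro order_trans[OF le])
qed

lemma Lp_norm_mono:
  assumes p: "1 \<le> p" and f: "f \<in> borel_measurable M" and g: "g \<in> borel_measurable M"
    and le: "AE x in M. \<bar>f x\<bar> \<le> \<bar>g x\<bar>"
  shows "Lp_norm p M f \<le> Lp_norm p M g"
proof (cases "p = \<infinity>")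
  case True
  have "AE x in M. ennreal \<bar>g x\<bar> \<le> Lp_norm \<infinity> M g"
    using Lp_norm_infinity_le_iff[OF g] by blast
  with le have "AE x in M. ennreal \<bar>f x\<bar> \<le> Lp_norm \<infinity> M g"
    by eventually_elim (metis ennreal_leI order_trans)
  then show ?thesis using True Lp_norm_infinity_le_iff[OF f] by auto
next
  case False
  have "(\<integral>\<^sup>+x. ennreal (\<bar>f x\<bar> powr enn2real p) \<partial>M) \<le> (\<integral>\<^sup>+x. ennreal (\<bar>g x\<bar> powr enn2real p) \<partial>M)"
    using le
    by (intro nn_integral_mono_AE, eventually_elim) (auto intro!: ennreal_leI powr_mono2)
  then show ?thesis by (rule Lp_norm_le_if_nn_integral_powr_le[OF p False])
qed

lemma Lp_norm_cong_AE:
  assumes "1 \<le> p" "f \<in> borel_measurable M" "g \<in> borel_measurable M" "AE x in M. f x = g x"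
  shows "Lp_norm p M f = Lp_norm p M g"
  using assms by (intro antisym Lp_norm_mono) auto

lemma Lp_norm_cmult_le:
  assumes p: "1 \<le> p" and f: "f \<in> borel_measurable M"
  shows "Lp_norm p M (\<lambda>x. c * f x) \<le> ennreal \<bar>c\<bar> * Lp_norm p M f"
proof (cases "p = \<infinity>")
  case True
  have [measurable]: "f \<in> borel_measurable M" by fact
  have "AE x in M. ennreal \<bar>f x\<bar> \<le> Lp_norm \<infinity> M f"
    using Lp_norm_infinity_le_iff[OF f] by blast
  then have "AE x in M. ennreal \<bar>c * f x\<bar> \<le> ennreal \<bar>c\<bar> * Lp_norm \<infinity> M f"
    by eventually_elim (simp add: abs_mult ennreal_mult mult_left_mono)
  then show ?thesis using True by (subst True, subst Lp_norm_infinity_le_iff) auto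
next
  case False
  let ?q = "enn2real p"
  have [measurable]: "f \<in> borel_measurable M" by fact
  show ?thesis
  \<comment> \<open>In \<open>ennreal\<close>, \<open>0 * \<infinity> = 0\<close>. For
    \<open>c = 0\<close> the right side therefore vanishes even if \<open>f\<close> has infinite
    norm, whereas for \<open>c \<noteq> 0\<close> an infinite norm makes the claim trivial.\<close>
  proof (cases "c = 0")
    case True
    then have "Lp_norm p M (\<lambda>x. c * f x) \<le> ennreal 0"
      using p False one_le_enn2real[OF p False] by (subst Lp_norm_le_iff) auto
    then show ?thesis by simp
  next
    case c: False
    show ?thesis
    proof (cases "Lp_norm p M f")
      case top
      then show ?thesis using c by (simp add: ennreal_mult_top)
    next
      case (real a)
      have "(\<integral>\<^sup>+x. ennreal (\<bar>c * f x\<bar> powr ?q) \<partial>M) =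
          ennreal (\<bar>c\<bar> powr ?q) * (\<integral>\<^sup>+x. ennreal (\<bar>f x\<bar> powr ?q) \<partial>M)"
        by (subst nn_integral_cmult[symmetric])
           (auto simp: abs_mult powr_mult ennreal_mult intro!: nn_integral_cong)
      also have "\<dots> \<le> ennreal (\<bar>c\<bar> powr ?q) * ennreal (a powr ?q)"
        using real p False by (intro mult_left_mono) (auto simp: Lp_norm_le_iff[symmetric])
      also have "\<dots> = ennreal ((\<bar>c\<bar> * a) powr ?q)"
        using real by (simp add: powr_mult ennreal_mult)
      finally have "Lp_norm p M (\<lambda>x. c * f x) \<le> ennreal (\<bar>c\<bar> * a)"
        using real p False by (subst Lp_norm_le_iff) auto
      then show ?thesis using real by (simp add: ennreal_mult)
    qed
  qed
qed

section \<open>Convexity of powers and Minkowski's inequality\<close>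

lemma powr_diff_one_mult:
  fixes c q :: real
  assumes "1 \<le> q" "0 \<le> c"
  shows "c powr (q - 1) * c = c powr q"
proof (cases "c = 0")
  case False
  then show ?thesis using assms(2) by (simp add: powr_mult_base mult.commute)
qed (use assms(1) in auto)

text \<open>The convex function \<open>z powr q\<close> lies above its tangent at \<open>c\<close>;
  the terms are arranged so that all are nonnegative and can be moved to \<open>ennreal\<close>.
  This is Young's inequality for \<open>z powr q\<close> and \<open>c powr q\<close> with weights
  \<open>1 / q\<close> and \<open>(q - 1) / q\<close>, multiplied by \<open>q\<close>. If
  \<open>c = 0\<close>, the left side is 0 even for \<open>q = 1\<close>, since
  \<open>0 powr 0 = 0\<close>.\<close>

lemma powr_tangent_le:
  fixes z c q :: real
  assumes "1 \<le> q" "0 \<le> z" "0 \<le> c"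
  shows "q * c powr (q - 1) * z \<le> z powr q + (q - 1) * c powr q"
proof (cases "z = 0 \<or> c = 0")
  case False
  then have "(z powr q) powr (1 / q) * (c powr q) powr ((q - 1) / q)
      \<le> (1 / q) * z powr q + ((q - 1) / q) * c powr q"
    using assms by (intro Youngs_inequality_0) (auto simp: field_simps)
  then have "z * c powr (q - 1) \<le> (1 / q) * z powr q + ((q - 1) / q) * c powr q"
    using assms by (simp add: powr_powr)
  then have "q * (z * c powr (q - 1)) \<le> q * ((1 / q) * z powr q + ((q - 1) / q) * c powr q)"
    using assms by (intro mult_left_mono) auto
  also have "\<dots> = z powr q + (q - 1) * c powr q"
    using assms by (simp add: distrib_left)
  finally show ?thesis by (simp add: mult_ac)
qed (use assms in auto)

text \<open>The quotient \<open>c = (s + t) / (a + b)\<close> is the convex combination of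
  \<open>s / a\<close> and \<open>t / b\<close> with weights \<open>a / (a + b)\<close> and
  \<open>b / (a + b)\<close>. Averaging the tangent inequalities at \<open>c\<close> with these
  weights gives convexity in the form that Minkowski's inequality uses, with \<open>a\<close> and
  \<open>b\<close> as bounds on the two norms.\<close>

lemma powr_add_le:
  fixes s t a b q :: real
  assumes q: "1 \<le> q" and "0 \<le> s" "0 \<le> t" "0 < a" "0 < b"
  shows "(s + t) powr q \<le> (a + b) powr q *
    (a / (a + b) * (s powr q / a powr q) + b / (a + b) * (t powr q / b powr q))"
proof -
  define c where "c = (s + t) / (a + b)"
  have c: "0 \<le> c" using assms by (simp add: c_def)
  have eq: "c = a / (a + b) * (s / a) + b / (a + b) * (t / b)"
    using assms by (simp add: c_def add_divide_distrib)
  have cq: "c powr (q - 1) * c = c powr q"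
    by (rule powr_diff_one_mult[OF q c])
  have 1: "a / (a + b) * (q * c powr (q - 1) * (s / a))
      \<le> a / (a + b) * ((s / a) powr q + (q - 1) * c powr q)"
    using assms c by (intro mult_left_mono powr_tangent_le) auto
  have 2: "b / (a + b) * (q * c powr (q - 1) * (t / b))
      \<le> b / (a + b) * ((t / b) powr q + (q - 1) * c powr q)"
    using assms c by (intro mult_left_mono powr_tangent_le) auto
  have w: "a / (a + b) + b / (a + b) = 1"
    using assms by (simp flip: add_divide_distrib)
  have "q * c powr q = q * c powr (q - 1) * c" using cq by simp
  also have "\<dots> = a / (a + b) * (q * c powr (q - 1) * (s / a))
      + b / (a + b) * (q * c powr (q - 1) * (t / b))"
    by (subst (2) eq) (simp only: distrib_left mult_ac)
  also have "\<dots> \<le> a / (a + b) * (s / a) powr q + b / (a + b) * (t / b) powr q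
      + (a / (a + b) + b / (a + b)) * ((q - 1) * c powr q)"
    using add_mono[OF 1 2] by (simp only: algebra_simps)
  finally have "c powr q \<le> a / (a + b) * (s / a) powr q + b / (a + b) * (t / b) powr q"
    unfolding w by (simp add: algebra_simps)
  moreover have "(s + t) powr q = (a + b) powr q * c powr q"
    using assms by (simp add: c_def powr_divide)
  ultimately show ?thesis
    using assms by (simp add: powr_divide mult_left_mono)
qed

text \<open>For finite \<open>p\<close>, if \<open>a\<close> and \<open>b\<close> are positive
  bounds on the norms, integrating \<open>powr_add_le\<close> yields at most
  \<open>(a + b) powr q\<close>, because the normalised integrals are at most 1 and the weights sum
  to 1.\<close>

lemma Lp_norm_triangle:
  assumes p: "1 \<le> p" and f: "f \<in> borel_measurable M" and g: "g \<in> borel_measurable M"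
  shows "Lp_norm p M (\<lambda>x. f x + g x) \<le> Lp_norm p M f + Lp_norm p M g"
proof (cases "p = \<infinity>")
  case True
  have [measurable]: "f \<in> borel_measurable M" "g \<in> borel_measurable M" by fact+
  have "AE x in M. ennreal \<bar>f x\<bar> \<le> Lp_norm \<infinity> M f" "AE x in M. ennreal \<bar>g x\<bar> \<le> Lp_norm \<infinity> M g"
    using Lp_norm_infinity_le_iff[OF f] Lp_norm_infinity_le_iff[OF g] by blast+
  then have "AE x in M. ennreal \<bar>f x + g x\<bar> \<le> Lp_norm \<infinity> M f + Lp_norm \<infinity> M g"
  proof eventually_elim
    case (elim x)
    have "ennreal \<bar>f x + g x\<bar> \<le> ennreal \<bar>f x\<bar> + ennreal \<bar>g x\<bar>"
      by (simp add: abs_triangle_ineq flip: ennreal_plus)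
    also have "\<dots> \<le> Lp_norm \<infinity> M f + Lp_norm \<infinity> M g" using elim by (rule add_mono)
    finally show ?case .
  qed
  then show ?thesis by (subst (1) True, subst Lp_norm_infinity_le_iff) (auto simp: True)
next
  case False
  let ?q = "enn2real p"
  have [measurable]: "f \<in> borel_measurable M" "g \<in> borel_measurable M" by fact+
  have q: "1 \<le> ?q" by (rule one_le_enn2real[OF p False])
  have pos: "Lp_norm p M (\<lambda>x. f x + g x) \<le> ennreal (a + b)"
    if a: "0 < a" "Lp_norm p M f \<le> ennreal a" and b: "0 < b" "Lp_norm p M g \<le> ennreal b" for a b
  proof -
    let ?c = "(a + b) powr ?q"
    let ?A = "a / (a + b) / a powr ?q" and ?B = "b / (a + b) / b powr ?q"
    have "(\<integral>\<^sup>+x. ennreal (\<bar>f x + g x\<bar> powr ?q) \<partial>M)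
        \<le> (\<integral>\<^sup>+x. ennreal ?c * (ennreal ?A * ennreal (\<bar>f x\<bar> powr ?q)
              + ennreal ?B * ennreal (\<bar>g x\<bar> powr ?q)) \<partial>M)"
    proof (rule nn_integral_mono)
      fix x
      have "\<bar>f x + g x\<bar> powr ?q \<le> (\<bar>f x\<bar> + \<bar>g x\<bar>) powr ?q"
        using q by (intro powr_mono2) auto
      also have "\<dots> \<le> ?c * (?A * (\<bar>f x\<bar> powr ?q) + ?B * (\<bar>g x\<bar> powr ?q))"
        using powr_add_le[OF q, of "\<bar>f x\<bar>" "\<bar>g x\<bar>" a b] a b by simp
      finally show "ennreal (\<bar>f x + g x\<bar> powr ?q) \<le> ennreal ?c *
          (ennreal ?A * ennreal (\<bar>f x\<bar> powr ?q) + ennreal ?B * ennreal (\<bar>g x\<bar> powr ?q))"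
        using a b by (simp add: ennreal_leI flip: ennreal_mult ennreal_plus)
    qed
    also have "\<dots> = ennreal ?c * (ennreal ?A * (\<integral>\<^sup>+x. ennreal (\<bar>f x\<bar> powr ?q) \<partial>M)
        + ennreal ?B * (\<integral>\<^sup>+x. ennreal (\<bar>g x\<bar> powr ?q) \<partial>M))"
      by (simp add: nn_integral_cmult nn_integral_add)
    also have "\<dots> \<le> ennreal ?c * (ennreal ?A * ennreal (a powr ?q) + ennreal ?B * ennreal (b powr ?q))"
      using a b p False by (intro mult_left_mono add_mono) (auto simp: Lp_norm_le_iff[symmetric])
    also have "\<dots> = ennreal (?c * (?A * a powr ?q + ?B * b powr ?q))"
      using a b by (simp flip: ennreal_mult ennreal_plus)
    also have "?A * a powr ?q + ?B * b powr ?q = 1"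
      using a b by (simp add: add_divide_distrib[symmetric])
    finally show ?thesis using a b p False by (subst Lp_norm_le_iff) auto
  qed
  show ?thesis
  proof (cases "Lp_norm p M f = \<infinity> \<or> Lp_norm p M g = \<infinity>")
    case fin: False
    then obtain a b where ab: "0 \<le> a" "0 \<le> b" "Lp_norm p M f = ennreal a" "Lp_norm p M g = ennreal b"
      by (cases "Lp_norm p M f"; cases "Lp_norm p M g") auto
    show ?thesis
    \<comment> \<open>A norm may be 0, and \<open>pos\<close> divides by its bounds, so each norm is
      enlarged by \<open>e / 2\<close>.\<close>
    proof (rule ennreal_le_epsilon)
      fix e :: real assume "0 < e"
      then have "Lp_norm p M (\<lambda>x. f x + g x) \<le> ennreal ((a + e / 2) + (b + e / 2))"
        using ab by (intro pos) (auto intro!: ennreal_leI)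
      also have "\<dots> = Lp_norm p M f + Lp_norm p M g + ennreal e"
        using ab \<open>0 < e\<close> by (simp flip: ennreal_plus)
      finally show "Lp_norm p M (\<lambda>x. f x + g x) \<le> Lp_norm p M f + Lp_norm p M g + ennreal e" .
    qed
  qed auto
qed

section \<open>Contractivity of averaging operators with a symmetric kernel\<close>

text \<open>Jensen's inequality for a probability measure consisting of the density \<open>\<kappa>\<close> and an atom of
  mass \<open>1 - d\<close> on which \<open>z\<close> has the value \<open>a\<close>. It is obtained by integrating the tangent
  line inequality at \<open>c\<close>, which needs no integrability of \<open>z\<close>.\<close>

lemma nn_integral_markov_powr:
  fixes z :: "'a \<Rightarrow> real" and a c q :: real
  assumes [measurable]: "\<kappa> \<in> borel_measurable M" "z \<in> borel_measurable M"
    and z: "\<And>y. 0 \<le> z y" and a: "0 \<le> a" and c: "0 \<le> c" and q: "1 \<le> q"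
    and d: "(\<integral>\<^sup>+y. \<kappa> y \<partial>M) = d" "d \<le> 1"
    and le: "ennreal c \<le> (\<integral>\<^sup>+y. \<kappa> y * ennreal (z y) \<partial>M) + (1 - d) * ennreal a"
  shows "ennreal (c powr q) \<le>
    (\<integral>\<^sup>+y. \<kappa> y * ennreal (z y powr q) \<partial>M) + (1 - d) * ennreal (a powr q)"
proof -
  \<comment> \<open>The tangent at \<open>c\<close> has slope \<open>?s\<close> and intercept
    \<open>- ?r\<close>. The intercept is kept on the other side because subtraction in
    \<open>ennreal\<close> is truncated.\<close>
  let ?s = "ennreal (q * c powr (q - 1))" and ?r = "ennreal ((q - 1) * c powr q)"
  let ?R = "(\<integral>\<^sup>+y. \<kappa> y * ennreal (z y powr q) \<partial>M) + (1 - d) * ennreal (a powr q)"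
  have tan: "?s * ennreal b \<le> ennreal (b powr q) + ?r" if "0 \<le> b" for b
    using powr_tangent_le[OF q that c] q c that
    by (simp add: ennreal_leI flip: ennreal_mult ennreal_plus)
  have cq: "c powr (q - 1) * c = c powr q"
    by (rule powr_diff_one_mult[OF q c])
  have "ennreal (c powr q) + ?r = ennreal (c powr q + (q - 1) * c powr q)"
    using q by (subst ennreal_plus) auto
  also have "c powr q + (q - 1) * c powr q = q * (c powr (q - 1) * c)"
    unfolding cq by (simp add: algebra_simps)
  also have "ennreal \<dots> = ?s * ennreal c"
    using q c by (simp add: ennreal_mult[symmetric] mult.assoc)
  also have "\<dots> \<le> ?s * ((\<integral>\<^sup>+y. \<kappa> y * ennreal (z y) \<partial>M) + (1 - d) * ennreal a)"
    using le by (rule mult_left_mono) simp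
  also have "\<dots> = (\<integral>\<^sup>+y. \<kappa> y * (?s * ennreal (z y)) \<partial>M) + (1 - d) * (?s * ennreal a)"
    by (simp add: distrib_left nn_integral_cmult[symmetric] mult_ac)
  also have "\<dots> \<le> (\<integral>\<^sup>+y. \<kappa> y * (ennreal (z y powr q) + ?r) \<partial>M) + (1 - d) * (ennreal (a powr q) + ?r)"
    using z a by (intro add_mono nn_integral_mono mult_left_mono tan) auto
  also have "\<dots> = ?R + (d + (1 - d)) * ?r"
    using d(1) by (simp add: distrib_left distrib_right nn_integral_add nn_integral_multc add_ac)
  also have "d + (1 - d) = 1"
    using d(2) by (simp add: add_diff_inverse_ennreal)
  \<comment> \<open>As the total mass is 1, \<open>?r\<close> occurs exactly once on each side;
    being finite, it cancels.\<close>
  finally have "?r + ennreal (c powr q) \<le> ?r + ?R" by (simp add: add.commute)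
  then show ?thesis by (simp add: ennreal_add_left_cancel_le)
qed

text \<open>If \<open>k * f\<close> is integrable, the left side is the absolute value of
  \<open>\<integral> k * f + (1 - d) * a\<close>, and the triangle inequality applies since
  \<open>1 - d \<ge> 0\<close>. Otherwise the right side is infinite, so the default value 0 of a
  Bochner integral does no harm.\<close>

lemma abs_integral_generator_le:
  fixes k f :: "'a \<Rightarrow> real" and a :: real
  assumes [measurable]: "k \<in> borel_measurable M" "f \<in> borel_measurable M"
    and k: "\<And>y. 0 \<le> k y"
    and d: "(\<integral>\<^sup>+y. ennreal (k y) \<partial>M) = d" "d \<le> 1"
  shows "ennreal \<bar>(\<integral>y. k y * (f y - a) \<partial>M) + a\<bar> \<le>
    (\<integral>\<^sup>+y. ennreal (k y) * ennreal \<bar>f y\<bar> \<partial>M) + (1 - d) * ennreal \<bar>a\<bar>"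
proof (cases "integrable M (\<lambda>y. k y * f y)")
  case True
  let ?D = "\<integral>y. k y \<partial>M"
  have intk: "integrable M k"
    using d k by (intro integrableI_bounded) (auto intro: le_less_trans[of _ 1])
  have D: "d = ennreal ?D"
    using nn_integral_eq_integral[OF intk] k d by simp
  have D1: "0 \<le> ?D" "?D \<le> 1"
    using d k unfolding D by (auto simp: ennreal_le_1)
  have inta: "integrable M (\<lambda>y. k y * \<bar>f y\<bar>)"
    using integrable_abs[OF True] k by (simp add: abs_mult)
  have "(\<integral>y. k y * (f y - a) \<partial>M) + a = (\<integral>y. k y * f y \<partial>M) + (1 - ?D) * a"
    using True intk by (simp add: algebra_simps)
  also have "\<bar>\<dots>\<bar> \<le> (\<integral>y. k y * \<bar>f y\<bar> \<partial>M) + (1 - ?D) * \<bar>a\<bar>"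
  proof -
    have "\<bar>\<integral>y. k y * f y \<partial>M\<bar> \<le> (\<integral>y. k y * \<bar>f y\<bar> \<partial>M)"
      using integral_abs_bound[of M "\<lambda>y. k y * f y"] k by (simp add: abs_mult)
    moreover have "\<bar>(1 - ?D) * a\<bar> = (1 - ?D) * \<bar>a\<bar>"
      using D1 by (simp add: abs_mult)
    ultimately show ?thesis by linarith
  qed
  finally have "ennreal \<bar>(\<integral>y. k y * (f y - a) \<partial>M) + a\<bar> \<le>
      ennreal ((\<integral>y. k y * \<bar>f y\<bar> \<partial>M) + (1 - ?D) * \<bar>a\<bar>)"
    by (rule ennreal_leI)
  also have "\<dots> = ennreal (\<integral>y. k y * \<bar>f y\<bar> \<partial>M) + ennreal (1 - ?D) * ennreal \<bar>a\<bar>"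
    using D1 k by (subst ennreal_plus) (auto simp: ennreal_mult intro!: integral_nonneg_AE)
  also have "ennreal (\<integral>y. k y * \<bar>f y\<bar> \<partial>M) = (\<integral>\<^sup>+y. ennreal (k y) * ennreal \<bar>f y\<bar> \<partial>M)"
    using nn_integral_eq_integral[OF inta] k by (simp add: ennreal_mult)
  also have "ennreal (1 - ?D) = 1 - d"
    using D1 by (simp add: D ennreal_minus flip: ennreal_1)
  finally show ?thesis .
next
  case False
  have "(\<lambda>y. k y * f y) \<in> borel_measurable M" by measurable
  from integrableI_bounded[OF this] False
  have "\<not> (\<integral>\<^sup>+y. ennreal (norm (k y * f y)) \<partial>M) < \<infinity>" by blast
  then have "(\<integral>\<^sup>+y. ennreal (norm (k y * f y)) \<partial>M) = \<infinity>"
    by (simp add: not_less top_unique)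
  then show ?thesis using k by (simp add: abs_mult ennreal_mult)
qed

text \<open>\<open>M\<close> is invariant under the Markov kernel with density \<open>k x\<close>
  and an atom at \<open>x\<close> carrying the missing mass. By Tonelli, the density part
  contributes the column mass at \<open>y\<close> times \<open>g y\<close>; by \<open>sym\<close>
  this is the row mass, and the atom supplies the rest.\<close>

lemma (in sigma_finite_measure) nn_integral_markov:
  assumes [measurable]: "case_prod k \<in> borel_measurable (M \<Otimes>\<^sub>M M)" "g \<in> borel_measurable M"
    and le1: "AE x in M. (\<integral>\<^sup>+y. k x y \<partial>M) \<le> 1"
    and sym: "AE y in M. (\<integral>\<^sup>+x. k x y \<partial>M) = (\<integral>\<^sup>+x. k y x \<partial>M)"
  shows "(\<integral>\<^sup>+x. (\<integral>\<^sup>+y. k x y * g y \<partial>M) + (1 - (\<integral>\<^sup>+y. k x y \<partial>M)) * g x \<partial>M) = (\<integral>\<^sup>+x. g x \<partial>M)"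
proof -
  interpret MM: pair_sigma_finite M M ..
  let ?d = "\<lambda>x. \<integral>\<^sup>+y. k x y \<partial>M"
  have "(\<integral>\<^sup>+x. \<integral>\<^sup>+y. k x y * g y \<partial>M \<partial>M) = (\<integral>\<^sup>+y. \<integral>\<^sup>+x. k x y * g y \<partial>M \<partial>M)"
    by (rule MM.Fubini'[symmetric]) measurable
  also have "\<dots> = (\<integral>\<^sup>+y. (\<integral>\<^sup>+x. k x y \<partial>M) * g y \<partial>M)"
    by (intro nn_integral_cong nn_integral_multc) measurable
  also have "\<dots> = (\<integral>\<^sup>+y. ?d y * g y \<partial>M)"
    using sym by (intro nn_integral_cong_AE) auto
  finally have "(\<integral>\<^sup>+x. (\<integral>\<^sup>+y. k x y * g y \<partial>M) + (1 - ?d x) * g x \<partial>M)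
      = (\<integral>\<^sup>+x. ?d x * g x + (1 - ?d x) * g x \<partial>M)"
    by (simp add: nn_integral_add)
  also have "\<dots> = (\<integral>\<^sup>+x. g x \<partial>M)"
    using le1
    by (intro nn_integral_cong_AE, eventually_elim)
       (simp add: distrib_right[symmetric] add_diff_inverse_ennreal)
  finally show ?thesis .
qed

text \<open>By \<open>ptw\<close>, \<open>\<bar>v + f\<bar>\<close> is dominated by the Markov
  average of \<open>\<bar>f\<bar>\<close>. For \<open>p = \<infinity>\<close>, an average of
  essentially bounded values obeys the same bound; for finite \<open>p\<close>, Jensen's inequality
  is followed by invariance of the integral under averaging.\<close>

lemma (in sigma_finite_measure) Lp_norm_markov_le:
  fixes k :: "'a \<Rightarrow> 'a \<Rightarrow> real" and f v :: "'a \<Rightarrow> real"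
  assumes p: "1 \<le> p"
    and [measurable]: "case_prod k \<in> borel_measurable (M \<Otimes>\<^sub>M M)"
      "f \<in> borel_measurable M" "v \<in> borel_measurable M"
    and k: "\<And>x y. 0 \<le> k x y"
    and le1: "AE x in M. (\<integral>\<^sup>+y. ennreal (k x y) \<partial>M) \<le> 1"
    and sym: "AE y in M. (\<integral>\<^sup>+x. ennreal (k x y) \<partial>M) = (\<integral>\<^sup>+x. ennreal (k y x) \<partial>M)"
    and v: "AE x in M. v x = (\<integral>y. k x y * (f y - f x) \<partial>M)"
  shows "Lp_norm p M (\<lambda>x. v x + f x) \<le> Lp_norm p M f"
proof -
  let ?d = "\<lambda>x. \<integral>\<^sup>+y. ennreal (k x y) \<partial>M"
  have ptw: "AE x in M. ennreal \<bar>v x + f x\<bar> \<le>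
      (\<integral>\<^sup>+y. ennreal (k x y) * ennreal \<bar>f y\<bar> \<partial>M) + (1 - ?d x) * ennreal \<bar>f x\<bar>"
    using le1 v AE_space
  proof eventually_elim
    case (elim x)
    then have [measurable]: "k x \<in> borel_measurable M" by measurable
    show ?case
      using abs_integral_generator_le[of "k x" M f "?d x" "f x"] k elim by simp
  qed
  show ?thesis
  proof (cases "p = \<infinity>")
    case True
    have f: "AE x in M. ennreal \<bar>f x\<bar> \<le> Lp_norm \<infinity> M f"
      using Lp_norm_infinity_le_iff[of f M] by auto
    have "AE x in M. ennreal \<bar>v x + f x\<bar> \<le> Lp_norm \<infinity> M f"
      using ptw le1 f AE_space
    proof eventually_elim
      case (elim x)
      let ?m = "Lp_norm \<infinity> M f"
      have [measurable]: "k x \<in> borel_measurable M" using elim by measurable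
      have "(\<integral>\<^sup>+y. ennreal (k x y) * ennreal \<bar>f y\<bar> \<partial>M) \<le> (\<integral>\<^sup>+y. ennreal (k x y) * ?m \<partial>M)"
        using f by (intro nn_integral_mono_AE, eventually_elim) (simp add: mult_left_mono)
      also have "\<dots> = ?d x * ?m" by (rule nn_integral_multc) measurable
      finally have "ennreal \<bar>v x + f x\<bar> \<le> ?d x * ?m + (1 - ?d x) * ?m"
        using elim by (auto intro!: order_trans[OF elim(1)] add_mono mult_left_mono)
      also have "\<dots> = ?m"
        using elim by (simp add: distrib_right[symmetric] add_diff_inverse_ennreal)
      finally show ?case .
    qed
    then show ?thesis using True Lp_norm_infinity_le_iff[of "\<lambda>x. v x + f x" M] by auto
  next
    case False
    let ?q = "enn2real p"
    have "AE x in M. ennreal (\<bar>v x + f x\<bar> powr ?q) \<le>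
        (\<integral>\<^sup>+y. ennreal (k x y) * ennreal (\<bar>f y\<bar> powr ?q) \<partial>M) + (1 - ?d x) * ennreal (\<bar>f x\<bar> powr ?q)"
      using ptw le1 AE_space
    proof eventually_elim
      case (elim x)
      have [measurable]: "k x \<in> borel_measurable M" using elim by measurable
      show ?case
        using elim by (intro nn_integral_markov_powr one_le_enn2real p False) auto
    qed
    then have "(\<integral>\<^sup>+x. ennreal (\<bar>v x + f x\<bar> powr ?q) \<partial>M) \<le>
        (\<integral>\<^sup>+x. (\<integral>\<^sup>+y. ennreal (k x y) * ennreal (\<bar>f y\<bar> powr ?q) \<partial>M)
            + (1 - ?d x) * ennreal (\<bar>f x\<bar> powr ?q) \<partial>M)"
      by (rule nn_integral_mono_AE)
    also have "\<dots> = (\<integral>\<^sup>+x. ennreal (\<bar>f x\<bar> powr ?q) \<partial>M)"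
      using le1 sym by (intro nn_integral_markov) measurable
    finally show ?thesis by (rule Lp_norm_le_if_nn_integral_powr_le[OF p False])
  qed
qed

section \<open>Lebesgue null sets, sections and Borel representatives\<close>

lemma AE_lebesgue_on_if_AE_lborel:
  assumes "AE x in lborel. P x" "S \<in> sets lebesgue"
  shows "AE x in lebesgue_on S. P x"
  using AE_completion[OF assms(1)] assms(2)
  by (subst AE_restrict_space_iff) auto

text \<open>Completeness of Lebesgue measure: on \<open>S\<close>, the preimages of a set under
  \<open>f\<close> and \<open>g\<close> differ only within a null set.\<close>

lemma borel_measurable_lebesgue_on_cong_AE:
  fixes f g :: "'a::euclidean_space \<Rightarrow> 'b::topological_space"
  assumes S: "S \<in> sets lebesgue" and f: "f \<in> borel_measurable (lebesgue_on S)"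
    and eq: "AE x in lebesgue_on S. f x = g x"
  shows "g \<in> borel_measurable (lebesgue_on S)"
proof (rule measurableI)
  fix A :: "'b set" assume A: "A \<in> sets borel"
  have ae: "AE x in lebesgue. x \<in> S \<longrightarrow> f x = g x"
    using eq S by (subst (asm) AE_restrict_space_iff) auto
  have fA: "f -` A \<inter> S \<in> sets lebesgue"
    using measurable_sets[OF f A] S by (simp add: sets_restrict_space_iff space_restrict_space)
  have "g -` A \<inter> S \<in> sets lebesgue"
    by (rule completion.in_sets_AE[OF _ fA]) (use ae in auto)
  then show "g -` A \<inter> space (lebesgue_on S) \<in> sets (lebesgue_on S)"
    using S by (simp add: sets_restrict_space_iff space_restrict_space)
qed auto

lemma integrable_lborel_imp_lebesgue_on:
  fixes f :: "'a::euclidean_space \<Rightarrow> real"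
  assumes "integrable lborel f" "S \<in> sets lebesgue"
  shows "integrable (lebesgue_on S) f"
proof -
  have "integrable lebesgue f"
    using assms(1) by (simp add: integrable_completion)
  then show ?thesis
    using assms(2) integrable_mult_indicator[of S lebesgue f]
    by (simp add: integrable_restrict_space)
qed

text \<open>The exceptional set is first enlarged to a Borel null set \<open>N\<close>. Borel sets
  of the product space belong to the product sigma-algebra, so almost every section of
  \<open>N\<close> is null in either order; general Lebesgue sets need not belong to the product of
  the completed sigma-algebras.\<close>

lemma AE_lebesgue_on_pair:
  fixes P :: "'a::euclidean_space \<times> 'b::euclidean_space \<Rightarrow> bool"
  assumes ae: "AE z in lborel. P z" and S: "S \<in> sets lebesgue" and R: "R \<in> sets lebesgue"
  shows "AE x in lebesgue_on S. AE y in lebesgue_on R. P (x, y)"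
    and "AE y in lebesgue_on R. AE x in lebesgue_on S. P (x, y)"
proof -
  from ae obtain N where N: "N \<in> null_sets lborel" "{z. \<not> P z} \<subseteq> N"
    by (auto simp: eventually_ae_filter)
  have ae': "AE z in lborel \<Otimes>\<^sub>M lborel. z \<notin> N"
    unfolding lborel_prod by (rule AE_not_in[OF N(1)])
  have [measurable]: "N \<in> sets (lborel \<Otimes>\<^sub>M lborel)"
    using N(1) unfolding lborel_prod by auto
  have 1: "AE x in lborel. AE y in lborel. (x, y) \<notin> N"
    using lborel_pair.AE_pair[OF ae'] by simp
  then have 2: "AE y in lborel. AE x in lborel. (x, y) \<notin> N"
    by (subst lborel_pair.AE_commute[symmetric]) measurable
  have P: "P z" if "z \<notin> N" for z using N(2) that by auto
  show "AE x in lebesgue_on S. AE y in lebesgue_on R. P (x, y)"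
    using AE_lebesgue_on_if_AE_lborel[OF 1 S]
    by eventually_elim (drule AE_lebesgue_on_if_AE_lborel[OF _ R], auto elim: eventually_mono intro: P)
  show "AE y in lebesgue_on R. AE x in lebesgue_on S. P (x, y)"
    using AE_lebesgue_on_if_AE_lborel[OF 2 R]
    by eventually_elim (drule AE_lebesgue_on_if_AE_lborel[OF _ S], auto elim: eventually_mono intro: P)
qed

text \<open>Extend \<open>F\<close> by 0 outside \<open>S\<close> and change it on a null set. A
  Borel representative is what makes joint measurability and Fubini's theorem available.\<close>

lemma integrable_lebesgue_on_borel_version:
  fixes F :: "'a::euclidean_space \<Rightarrow> real"
  assumes F: "integrable (lebesgue_on S) F" and S: "S \<in> sets lebesgue"
  obtains g where "integrable lborel g" "AE z in lborel. z \<in> S \<longrightarrow> F z = g z"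
proof -
  have int: "integrable lebesgue (\<lambda>z. indicator S z *\<^sub>R F z)"
    using F S by (simp add: integrable_restrict_space)
  obtain g where g: "g \<in> borel_measurable lborel" "AE z in lborel. indicator S z *\<^sub>R F z = g z"
    using completion_ex_borel_measurable_real[OF borel_measurable_integrable[OF int]] by blast
  have "integrable lebesgue g"
    using int AE_completion[OF g(2)] g(1)
    by (subst integrable_cong_AE[where g="\<lambda>z. indicator S z *\<^sub>R F z"])
       (auto intro: measurable_completion)
  then have "integrable lborel g" using g(1) by (simp add: integrable_completion)
  moreover have "AE z in lborel. z \<in> S \<longrightarrow> F z = g z"
    using g(2) by eventually_elim auto
  ultimately show thesis by (rule that)
qed

section \<open>A monotonicity criterion of Dini type\<close>

text \<open>With a slack \<open>e\<close> per unit time, consider the compact set of times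
  \<open>s\<close> in \<open>{0..t}\<close> from which \<open>N\<close> grows by at most
  \<open>e * (t - s)\<close> until \<open>t\<close>. Its least element must be 0, since
  \<open>dini\<close> leads further left from any positive one.\<close>

lemma dini_antimono:
  fixes N :: "real \<Rightarrow> real"
  assumes cont: "continuous_on {0..T} N"
    and dini: "\<And>t e. 0 < t \<Longrightarrow> t \<le> T \<Longrightarrow> 0 < e \<Longrightarrow> \<exists>s. 0 \<le> s \<and> s < t \<and> N t \<le> N s + e * (t - s)"
    and t: "0 \<le> t" "t \<le> T"
  shows "N t \<le> N 0"
proof (rule field_le_epsilon)
  fix e' :: real assume e': "0 < e'"
  \<comment> \<open>Dividing by \<open>t + 1\<close> rather than \<open>t\<close> also covers
    \<open>t = 0\<close>.\<close>
  define e where "e = e' / (t + 1)"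
  have e: "0 < e" "e * t \<le> e'"
    using e' t by (auto simp: e_def field_simps)
  define S where "S = {s\<in>{0..t}. N t \<le> N s + e * (t - s)}"
  have "closed S"
    unfolding S_def using t
    by (intro continuous_on_closed_Collect_le continuous_intros continuous_on_subset[OF cont]) auto
  moreover have "bounded S" unfolding S_def by (rule bounded_subset[of "{0..t}"]) auto
  ultimately have "compact S" by (simp add: compact_eq_bounded_closed)
  moreover have "t \<in> S" using t by (simp add: S_def)
  ultimately obtain s0 where s0: "s0 \<in> S" "\<And>s. s \<in> S \<Longrightarrow> s0 \<le> s"
    using compact_attains_inf[of S] by blast
  have "s0 = 0"
  proof (rule ccontr)
    assume "s0 \<noteq> 0"
    then have "0 < s0" "s0 \<le> T" using s0(1) t by (auto simp: S_def)
    \<comment> \<open>The slacks on \<open>{s..s0}\<close> and \<open>{s0..t}\<close> add up to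
      \<open>e * (t - s)\<close>, so \<open>s\<close> lies in \<open>S\<close> and contradicts
      minimality of \<open>s0\<close>.\<close>
    from dini[OF this e(1)] obtain s where s: "0 \<le> s" "s < s0" "N s0 \<le> N s + e * (s0 - s)" by blast
    then have "s \<in> S" using s0(1) by (auto simp: S_def algebra_simps)
    with s0(2)[of s] s(2) show False by simp
  qed
  then have "N t \<le> N 0 + e * t" using s0(1) by (simp add: S_def)
  with e(2) show "N t \<le> N 0 + e'" by simp
qed

section \<open>The graphon operator plus the identity is a contraction\<close>

text \<open>\<open>W\<close> is Lebesgue measurable on the square but need not be measurable for the
  product sigma-algebra. It is replaced by a Borel kernel \<open>k\<close> that agrees with it
  almost everywhere, and \<open>Lp_norm_markov_le\<close> is applied to \<open>k\<close>.\<close>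

lemma Lp_norm_graphon_diffusion_le:
  fixes W :: "real \<Rightarrow> real \<Rightarrow> real"
  assumes p: "1 \<le> p"
    and W: "integrable (lebesgue_on ({0<..<1} \<times> {0<..<1})) (\<lambda>(x, y). W x y)"
    and sym: "\<And>x y. x \<in> {0<..<1} \<Longrightarrow> y \<in> {0<..<1} \<Longrightarrow> W x y = W y x"
    and nonneg: "\<And>x y. x \<in> {0<..<1} \<Longrightarrow> y \<in> {0<..<1} \<Longrightarrow> 0 \<le> W x y"
    and le1: "AE x in unit_leb. (\<integral>y. W x y \<partial>unit_leb) \<le> 1"
    and f[measurable]: "f \<in> borel_measurable unit_leb"
    and v[measurable]: "v \<in> borel_measurable unit_leb"
    and vL: "AE x in unit_leb. v x = graphon_diffusion W f x"
  shows "Lp_norm p unit_leb (\<lambda>x. v x + f x) \<le> Lp_norm p unit_leb f"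
proof -
  let ?S = "{0<..<1::real}"
  have S: "?S \<in> sets lebesgue" by auto
  have SS: "?S \<times> ?S \<in> sets lebesgue"
    using borel_open[OF open_Times[of ?S ?S]] by auto
  interpret finite_measure unit_leb
    by (rule finite_measure_lebesgue_on) auto
  obtain g where g: "integrable lborel g"
      and Wg: "AE z in lborel. z \<in> ?S \<times> ?S \<longrightarrow> (case z of (x, y) \<Rightarrow> W x y) = g z"
    using integrable_lebesgue_on_borel_version[OF W SS] by blast
  \<comment> \<open>Truncation makes \<open>k\<close> nonnegative everywhere; wherever
    \<open>g\<close> agrees with \<open>W\<close> on the square it changes nothing.\<close>
  define k where "k x y = max 0 (g (x, y))" for x y
  have [measurable]: "g \<in> borel_measurable borel"
    using borel_measurable_integrable[OF g] by simp
  have id[measurable]: "(\<lambda>x. x) \<in> borel_measurable unit_leb"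
    using id_borel_measurable_lebesgue_on[of ?S] by (simp add: id_def)
  have k_meas: "case_prod k \<in> borel_measurable (unit_leb \<Otimes>\<^sub>M unit_leb)"
    unfolding k_def by measurable
  have "AE x in unit_leb. AE y in unit_leb. (x, y) \<in> ?S \<times> ?S \<longrightarrow> W x y = g (x, y)"
    using AE_lebesgue_on_pair(1)[OF Wg S S] by simp
  then have Wk1: "AE x in unit_leb. AE y in unit_leb. W x y = k x y"
    using AE_space
  proof eventually_elim
    case (elim x)
    then have x: "x \<in> ?S" by simp
    from elim(1) AE_space show ?case
    proof eventually_elim
      case (elim y)
      then show ?case using nonneg[of x y] x by (simp add: k_def)
    qed
  qed
  have "AE y in unit_leb. AE x in unit_leb. (x, y) \<in> ?S \<times> ?S \<longrightarrow> W x y = g (x, y)"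
    using AE_lebesgue_on_pair(2)[OF Wg S S] by simp
  \<comment> \<open>Symmetry of \<open>W\<close> enters here. Together with \<open>Wk1\<close> it
    gives \<open>k x y = k y x\<close> for almost all \<open>x\<close>, for almost every
    \<open>y\<close>, hence equal row and column masses.\<close>
  then have Wk2: "AE y in unit_leb. AE x in unit_leb. W y x = k x y"
    using AE_space
  proof eventually_elim
    case (elim y)
    then have y: "y \<in> ?S" by simp
    from elim(1) AE_space show ?case
    proof eventually_elim
      case (elim x)
      then show ?case using nonneg[of x y] sym[of x y] y by (simp add: k_def)
    qed
  qed
  \<comment> \<open>The bound \<open>le1\<close> concerns a Bochner integral, which would be 0 on a
    non-integrable section. Fubini's theorem makes almost every section integrable, so the bound
    passes to the nonnegative integral.\<close>
  have "integrable (lborel \<Otimes>\<^sub>M lborel) g"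
    using g by (simp add: lborel_prod)
  then have "AE x in lborel. integrable lborel (\<lambda>y. g (x, y))"
    by (rule lborel_pair.AE_integrable_fst')
  then have "AE x in unit_leb. integrable lborel (\<lambda>y. g (x, y))"
    using S by (rule AE_lebesgue_on_if_AE_lborel)
  then have k_int: "AE x in unit_leb. integrable unit_leb (k x)"
    by eventually_elim (auto simp: k_def[abs_def] intro!: integrable_lborel_imp_lebesgue_on)
  have k_sect: "k x \<in> borel_measurable unit_leb" for x
    unfolding k_def by measurable
  have W_sect: "W x \<in> borel_measurable unit_leb" if "AE y in unit_leb. W x y = k x y" for x
    using that by (intro borel_measurable_lebesgue_on_cong_AE[OF S k_sect[of x]]) auto
  show ?thesis
  proof (rule Lp_norm_markov_le[OF p k_meas f v])
    show "0 \<le> k x y" for x y by (simp add: k_def)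
    show "AE x in unit_leb. (\<integral>\<^sup>+y. ennreal (k x y) \<partial>unit_leb) \<le> 1"
      using Wk1 k_int le1
    proof eventually_elim
      case (elim x)
      have "(\<integral>\<^sup>+y. ennreal (k x y) \<partial>unit_leb) = ennreal (\<integral>y. k x y \<partial>unit_leb)"
        using elim(2) by (intro nn_integral_eq_integral) (auto simp: k_def[abs_def])
      also have "(\<integral>y. k x y \<partial>unit_leb) = (\<integral>y. W x y \<partial>unit_leb)"
        using elim(1) by (intro integral_cong_AE k_sect W_sect) auto
      finally show ?case using elim(3) by simp
    qed
    show "AE y in unit_leb. (\<integral>\<^sup>+x. ennreal (k x y) \<partial>unit_leb) = (\<integral>\<^sup>+x. ennreal (k y x) \<partial>unit_leb)"
      using Wk1 Wk2
    proof eventually_elim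
      case (elim y)
      from elim have "AE x in unit_leb. k x y = k y x" by eventually_elim simp
      then show ?case by (intro nn_integral_cong_AE) auto
    qed
    show "AE x in unit_leb. v x = (\<integral>y. k x y * (f y - f x) \<partial>unit_leb)"
      using vL Wk1
    proof eventually_elim
      case (elim x)
      have [measurable]: "W x \<in> borel_measurable unit_leb" "k x \<in> borel_measurable unit_leb"
        using W_sect[OF elim(2)] k_sect by auto
      have "graphon_diffusion W f x = (\<integral>y. k x y * (f y - f x) \<partial>unit_leb)"
        unfolding graphon_diffusion_def using elim(2) by (intro integral_cong_AE) auto
      then show ?case using elim(1) by simp
    qed
  qed
qed

section \<open>Real-valued norm estimates and evolution in time\<close>

text \<open>On \<open>Lp_space\<close> the norm is finite, so \<open>enn2real\<close> loses nothing
  and later estimates can use real arithmetic with subtraction.\<close>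

lemma Lp_space_add:
  assumes p: "1 \<le> p" and f: "f \<in> Lp_space p M" and g: "g \<in> Lp_space p M"
  shows "(\<lambda>x. f x + g x) \<in> Lp_space p M"
    and "enn2real (Lp_norm p M (\<lambda>x. f x + g x)) \<le> enn2real (Lp_norm p M f) + enn2real (Lp_norm p M g)"
proof -
  have fin: "Lp_norm p M f + Lp_norm p M g < \<infinity>"
    using f g by (auto simp: Lp_space_def)
  have le: "Lp_norm p M (\<lambda>x. f x + g x) \<le> Lp_norm p M f + Lp_norm p M g"
    using f g by (intro Lp_norm_triangle[OF p]) (auto simp: Lp_space_def)
  then show "(\<lambda>x. f x + g x) \<in> Lp_space p M"
    using f g fin by (auto simp: Lp_space_def intro: le_less_trans)
  show "enn2real (Lp_norm p M (\<lambda>x. f x + g x)) \<le> enn2real (Lp_norm p M f) + enn2real (Lp_norm p M g)"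
    using enn2real_mono[OF le] fin by (simp add: enn2real_plus)
qed

lemma Lp_space_cmult:
  assumes p: "1 \<le> p" and f: "f \<in> Lp_space p M"
  shows "(\<lambda>x. c * f x) \<in> Lp_space p M"
    and "enn2real (Lp_norm p M (\<lambda>x. c * f x)) \<le> \<bar>c\<bar> * enn2real (Lp_norm p M f)"
proof -
  have fin: "ennreal \<bar>c\<bar> * Lp_norm p M f < \<infinity>"
    using f by (auto simp: Lp_space_def ennreal_mult_less_top)
  have le: "Lp_norm p M (\<lambda>x. c * f x) \<le> ennreal \<bar>c\<bar> * Lp_norm p M f"
    using f by (intro Lp_norm_cmult_le[OF p]) (auto simp: Lp_space_def)
  then show "(\<lambda>x. c * f x) \<in> Lp_space p M"
    using f fin by (auto simp: Lp_space_def intro: le_less_trans)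
  show "enn2real (Lp_norm p M (\<lambda>x. c * f x)) \<le> \<bar>c\<bar> * enn2real (Lp_norm p M f)"
    using enn2real_mono[OF le] fin by (simp add: enn2real_mult)
qed

lemma Lp_space_diff:
  assumes p: "1 \<le> p" and f: "f \<in> Lp_space p M" and g: "g \<in> Lp_space p M"
  shows "(\<lambda>x. f x - g x) \<in> Lp_space p M"
  using Lp_space_add(1)[OF p f Lp_space_cmult(1)[OF p g, of "-1"]] by simp

lemma Lp_norm_diff_triangle:
  assumes p: "1 \<le> p" and f: "f \<in> Lp_space p M" and g: "g \<in> Lp_space p M"
  shows "\<bar>enn2real (Lp_norm p M f) - enn2real (Lp_norm p M g)\<bar> \<le> enn2real (Lp_norm p M (\<lambda>x. f x - g x))"
proof -
  note d = Lp_space_diff[OF p f g]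
  note d' = Lp_space_cmult[OF p d, of "-1"]
  show ?thesis
    using Lp_space_add(2)[OF p d g] Lp_space_add(2)[OF p d'(1) f] d'(2) by simp
qed

lemma continuous_on_Lp_norm:
  assumes p: "1 \<le> p" and u: "Lp_continuous_on p M S u"
  shows "continuous_on S (\<lambda>t. enn2real (Lp_norm p M (u t)))"
  unfolding continuous_on_def
proof
  fix t assume t: "t \<in> S"
  have uS: "u s \<in> Lp_space p M" if "s \<in> S" for s
    using u that by (auto simp: Lp_continuous_on_def)
  have "((\<lambda>s. Lp_norm p M (\<lambda>x. u s x - u t x)) \<longlongrightarrow> ennreal 0) (at t within S)"
    using u t by (auto simp: Lp_continuous_on_def)
  then have "((\<lambda>s. enn2real (Lp_norm p M (\<lambda>x. u s x - u t x))) \<longlongrightarrow> 0) (at t within S)"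
    by (rule tendsto_enn2real) simp
  then have "((\<lambda>s. enn2real (Lp_norm p M (u s)) - enn2real (Lp_norm p M (u t))) \<longlongrightarrow> 0) (at t within S)"
    by (rule Lim_null_comparison[rotated])
       (use Lp_norm_diff_triangle[OF p uS uS[OF t]] in \<open>auto simp: eventually_at_filter\<close>)
  then show "((\<lambda>s. enn2real (Lp_norm p M (u s))) \<longlongrightarrow> enn2real (Lp_norm p M (u t))) (at t within S)"
    by (rule LIM_zero_cancel)
qed

text \<open>An implicit Euler step from \<open>s = t - h\<close> to \<open>t\<close>, with error
  \<open>h * r s\<close>, bounds \<open>(1 + h)\<close> times the norm at \<open>t\<close> by the
  norm at \<open>s\<close> plus \<open>h\<close> times the norm at \<open>t\<close> plus
  \<open>h * e\<close>. Cancelling leaves the condition of \<open>dini_antimono\<close>.\<close>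

lemma Lp_norm_le_initial_if_resolvent_bound:
  assumes p: "1 \<le> p"
    and u: "has_C1_Lp_derivative p M {0..T} u v"
    and contr: "\<And>t. t \<in> {0..T} \<Longrightarrow> Lp_norm p M (\<lambda>x. v t x + u t x) \<le> Lp_norm p M (u t)"
    and t: "t \<in> {0..T}"
  shows "Lp_norm p M (u t) \<le> Lp_norm p M (u 0)"
proof -
  let ?N = "\<lambda>f. enn2real (Lp_norm p M f)"
  have uc: "Lp_continuous_on p M {0..T} u"
    and uL: "\<And>s. s \<in> {0..T} \<Longrightarrow> u s \<in> Lp_space p M"
    and vL: "\<And>s. s \<in> {0..T} \<Longrightarrow> v s \<in> Lp_space p M"
    using u by (auto simp: has_C1_Lp_derivative_def Lp_continuous_on_def)
  have "?N (u t) \<le> ?N (u 0)"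
  proof (rule dini_antimono[where T=T])
    show "continuous_on {0..T} (\<lambda>t. ?N (u t))"
      by (rule continuous_on_Lp_norm[OF p uc])
    show "0 \<le> t" "t \<le> T" using t by auto
  next
    fix t e :: real assume t: "0 < t" "t \<le> T" and e: "0 < e"
    then have tT: "t \<in> {0..T}" by simp
    define r where "r s x = (u s x - u t x) / (s - t) - v t x" for s x
    have "((\<lambda>s. Lp_norm p M (r s)) \<longlongrightarrow> ennreal 0) (at t within {0..T})"
      using u tT by (auto simp: has_C1_Lp_derivative_def r_def[abs_def])
    then have "((\<lambda>s. ?N (r s)) \<longlongrightarrow> 0) (at t within {0..T})"
      by (rule tendsto_enn2real) simp
    from order_tendstoD(2)[OF this e] obtain d where d: "0 < d"
        "\<And>s. s \<in> {0..T} \<Longrightarrow> s \<noteq> t \<Longrightarrow> dist s t < d \<Longrightarrow> ?N (r s) < e"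
      unfolding eventually_at by blast
    \<comment> \<open>The maximum with 0 keeps \<open>s\<close> in the time interval;
      \<open>d / 2\<close> keeps it strictly within distance \<open>d\<close> of
      \<open>t\<close>.\<close>
    define s where "s = max 0 (t - d / 2)"
    define h where "h = t - s"
    have s: "0 \<le> s" "s < t" "s \<in> {0..T}" and h: "0 < h"
      using t d(1) by (auto simp: s_def h_def)
    have "dist s t < d" using t d(1) by (auto simp: s_def dist_real_def)
    with s have re: "?N (r s) < e" by (intro d(2)) auto
    note diff = Lp_space_diff[OF p uL[OF s(3)] uL[OF tT]]
    have rL: "r s \<in> Lp_space p M"
      using Lp_space_diff[OF p Lp_space_cmult(1)[OF p diff, of "1 / (s - t)"] vL[OF tT]]
      by (simp add: r_def[abs_def])
    note vu = Lp_space_add[OF p vL[OF tT] uL[OF tT]]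
    have vu_le: "?N (\<lambda>x. v t x + u t x) \<le> ?N (u t)"
      using contr[OF tT] uL[OF tT] by (intro enn2real_mono) (auto simp: Lp_space_def)
    note hvu = Lp_space_cmult[OF p vu(1), of h] and hr = Lp_space_cmult[OF p rL, of h]
    note sum1 = Lp_space_add[OF p hvu(1) hr(1)]
    note sum2 = Lp_space_add[OF p uL[OF s(3)] sum1(1)]
    have "h * r s x = u t x - u s x - h * v t x" for x
    proof -
      have "h * ((u s x - u t x) / (s - t)) = u t x - u s x"
        using s by (simp add: h_def field_simps)
      then show ?thesis by (simp add: r_def right_diff_distrib)
    qed
    \<comment> \<open>Adding \<open>h * u t x\<close> to both sides produces
      \<open>v t x + u t x\<close>, the combination controlled by \<open>contr\<close>.\<close>
    then have eq: "u t x = 1 / (1 + h) * (u s x + (h * (v t x + u t x) + h * r s x))" for x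
      using h by (simp add: field_simps)
    have "?N (u t) \<le> 1 / (1 + h) * ?N (\<lambda>x. u s x + (h * (v t x + u t x) + h * r s x))"
      using Lp_space_cmult(2)[OF p sum2(1), of "1 / (1 + h)"] h unfolding eq[symmetric] by simp
    also have "\<dots> \<le> 1 / (1 + h) * (?N (u s) + (h * ?N (u t) + h * e))"
    proof -
      have "h * ?N (\<lambda>x. v t x + u t x) \<le> h * ?N (u t)" "h * ?N (r s) \<le> h * e"
        using vu_le re h by auto
      then have "?N (\<lambda>x. u s x + (h * (v t x + u t x) + h * r s x))
          \<le> ?N (u s) + (h * ?N (u t) + h * e)"
        using sum2(2) sum1(2) hvu(2) hr(2) unfolding abs_of_pos[OF h] by linarith
      then show ?thesis using h by (intro mult_left_mono) auto
    qed
    finally have "?N (u t) \<le> ?N (u s) + e * (t - s)"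
      using h by (simp add: field_simps flip: h_def)
    with s show "\<exists>s. 0 \<le> s \<and> s < t \<and> ?N (u t) \<le> ?N (u s) + e * (t - s)" by blast
  qed
  then have "ennreal (?N (u t)) \<le> ennreal (?N (u 0))" by (rule ennreal_leI)
  moreover have "Lp_norm p M (u t) < top" "Lp_norm p M (u 0) < top"
    using uL[OF t] uL[of 0] t by (auto simp: Lp_space_def)
  ultimately show ?thesis by (simp only: ennreal_enn2real)
qed

theorem lemma3p1:
  fixes p :: ennreal and T :: real
    and W :: "real \<Rightarrow> real \<Rightarrow> real"
    and u0 :: "real \<Rightarrow> real" and u :: "real \<Rightarrow> real \<Rightarrow> real"
  assumes "1 \<le> p" and "T > 0"
    and "integrable (lebesgue_on ({0<..<1} \<times> {0<..<1})) (\<lambda>(x, y). W x y)"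
    and "\<And>x y. x \<in> {0<..<1} \<Longrightarrow> y \<in> {0<..<1} \<Longrightarrow> W x y = W y x"
    and "\<And>x y. x \<in> {0<..<1} \<Longrightarrow> y \<in> {0<..<1} \<Longrightarrow> 0 \<le> W x y"
    and "AE x in unit_leb. (\<integral>y. W x y \<partial>unit_leb) \<le> 1"
    and "u0 \<in> Lp_space p unit_leb"
    and "classical_solution p W T u0 u"
  shows "(SUP t\<in>{0..T}. Lp_norm p unit_leb (u t)) \<le> Lp_norm p unit_leb u0"
proof (rule SUP_least)
  fix t assume t: "t \<in> {0..T}"
  from assms(8) obtain v where v: "has_C1_Lp_derivative p unit_leb {0..T} u v"
      and vL: "\<And>t. t \<in> {0..T} \<Longrightarrow> AE x in unit_leb. v t x = graphon_diffusion W (u t) x"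
      and init: "AE x in unit_leb. u 0 x = u0 x"
    by (auto simp: classical_solution_def)
  have meas: "u s \<in> borel_measurable unit_leb" "v s \<in> borel_measurable unit_leb" if "s \<in> {0..T}" for s
    using v that by (auto simp: has_C1_Lp_derivative_def Lp_continuous_on_def Lp_space_def)
  have "Lp_norm p unit_leb (u t) \<le> Lp_norm p unit_leb (u 0)"
    using assms(1) v _ t
  proof (rule Lp_norm_le_initial_if_resolvent_bound)
    fix s assume "s \<in> {0..T}"
    then show "Lp_norm p unit_leb (\<lambda>x. v s x + u s x) \<le> Lp_norm p unit_leb (u s)"
      by (intro Lp_norm_graphon_diffusion_le[OF assms(1,3-6)] meas vL)
  qed
  \<comment> \<open>The initial condition is an identity in \<open>L\<^sup>p\<close>:
    \<open>u 0\<close> and \<open>u0\<close> may differ on a null set, which the norm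
    ignores.\<close>
  also have "\<dots> = Lp_norm p unit_leb u0"
    using assms(1,2,7) meas(1)[of 0] init by (intro Lp_norm_cong_AE) (auto simp: Lp_space_def)
  finally show "Lp_norm p unit_leb (u t) \<le> Lp_norm p unit_leb u0" .
qed

end
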